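(* Consider the classical full transformation semigroup $\mathcal{T}_n$. (a) $\mathfrak{I}(\mathcal{T}_1)=\mathfrak{CI}(\mathcal{T}_1)=\mathfrak{LC}(\mathcal{T}_1)=\mathfrak{RC}(\mathcal{T}_1)=\mathfrak{C}(\mathcal{T}_1)=\{\mathcal{T}_1\}$. (b) For $n=2$: (i) $\mathfrak{I}(\mathcal{T}_2)=\{\mathcal{T}_2,\ \mathcal{S}(\{1,2\}),\ \mathcal{T}_2\setminus\mathcal{S}(\{1,2\}),\ G(\varepsilon_{1,2}),\ G(\varepsilon_{2,1})\}$; (ii) $\mathfrak{CI}(\mathcal{T}_2)=\{\mathcal{T}_2,\ \mathcal{S}(\{1,2\}),\ \mathcal{T}_2\setminus\mathcal{S}(\{1,2\})\}$; (iii) $\mathfrak{LC}(\mathcal{T}_2)=\mathfrak{RC}(\mathcal{T}_2)=\mathfrak{C}(\mathcal{T}_2)=\{\mathcal{S}(\{1,2\}),\mathcal{T}_2\}$. (c) Let $n>2$ and $N=\{1,\dots,n\}$. Then (i) $$\mathfrak{I}(\mathcal{T}_n)=\{\mathcal{T}_n,\mathcal{S}(N),\mathcal{T}_n\setminus\mathcal{S}(N)\}\cup\Big\{\bigcup_{m\in M}G(\varepsilon_{m,k}): k\in N,\ \varnothing\neq M\subseteq N\setminus\{k\}\Big\}\cup\{G(\varepsilon_{m,k})\cup G(\varepsilon_{k,m}): m,k\in N,\ m\ne k\};$$ (ii) $\mathfrak{CI}(\mathcal{T}_n)=\{\mathcal{T}_n,\mathcal{S}(N),\mathcal{T}_n\setminus\mathcal{S}(N)\}$;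 (iii) $\mathfrak{LC}(\mathcal{T}_n)=\mathfrak{RC}(\mathcal{T}_n)=\mathfrak{C}(\mathcal{T}_n)=\{\mathcal{S}(N),\mathcal{T}_n\}$.
   Context: $\mathcal{T}_n$ is the semigroup of all maps from $N=\{1,\dots,n\}$ to itself under composition from left to right, $(\beta\gamma)(x)=\gamma(\beta(x))$. $\mathcal{S}(X)$ is the symmetric group on the set $X$. For $m,k\in N$, $m\neq k$, $\varepsilon_{m,k}\in\mathcal{T}_n$ is the idempotent with $\varepsilon_{m,k}(k)=m$ and $\varepsilon_{m,k}(x)=x$ for $x\ne k$. $G(\varepsilon_{m,k})$ is the maximal subgroup of $\mathcal{T}_n$ with identity $\varepsilon_{m,k}$; it consists of all $\beta\in\mathcal{T}_n$ such that $\beta(m)=\beta(k)$ and $\beta$ induces a permutation of $N\setminus\{k\}$. Subsemigroups are non-empty. A subsemigroup $T$ of a semigroup $S$ is: isolated if $x^j\in T$ for some $j>0$ implies $x\in T$; completely isolated if $xy\in T$ implies $x\in T$ or $y\in T$; right convex if $xy\in T$ implies $y\in T$; left convex if $xy\in T$ implies $x\in T$; convex if $xy\in T$ implies $x\in T$ and $y\in T$ (for all $x,y\in S$). $\mathfrak{I}(S)$, $\mathfrak{CI}(S)$, $\mathfrak{RC}(S)$, $\mathfrak{LC}(S)$, $\mathfrak{C}(S)$ denote the sets of all isolated, completely isolated, right convex, left convex, and convex subsemigroups of $S$, respectively. *)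

theory Defs
  imports "HOL-Algebra.Bij"
begin

text \<open>A subsemigroup is non-empty and need not contain \<open>\<one>\<close>, unlike the library's \<open>submonoid\<close>.\<close>

definition subsemigroup :: "'a set \<Rightarrow> ('a, 'b) monoid_scheme \<Rightarrow> bool" where
  "subsemigroup T S \<longleftrightarrow>
     T \<noteq> {} \<and> T \<subseteq> carrier S \<and> (\<forall>x\<in>T. \<forall>y\<in>T. x \<otimes>\<^bsub>S\<^esub> y \<in> T)"

definition isolated_subsemigroups :: "('a, 'b) monoid_scheme \<Rightarrow> 'a set set" where
  "isolated_subsemigroups S =
     {T. subsemigroup T S \<and>
         (\<forall>x\<in>carrier S. (\<exists>j>0. x [^]\<^bsub>S\<^esub> (j::nat) \<in> T) \<longrightarrow> x \<in> T)}"

definition completely_isolated_subsemigroups :: "('a, 'b) monoid_scheme \<Rightarrow> 'a set set" where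
  "completely_isolated_subsemigroups S =
     {T. subsemigroup T S \<and>
         (\<forall>x\<in>carrier S. \<forall>y\<in>carrier S. x \<otimes>\<^bsub>S\<^esub> y \<in> T \<longrightarrow> x \<in> T \<or> y \<in> T)}"

definition right_convex_subsemigroups :: "('a, 'b) monoid_scheme \<Rightarrow> 'a set set" where
  "right_convex_subsemigroups S =
     {T. subsemigroup T S \<and>
         (\<forall>x\<in>carrier S. \<forall>y\<in>carrier S. x \<otimes>\<^bsub>S\<^esub> y \<in> T \<longrightarrow> y \<in> T)}"

definition left_convex_subsemigroups :: "('a, 'b) monoid_scheme \<Rightarrow> 'a set set" where
  "left_convex_subsemigroups S =
     {T. subsemigroup T S \<and>
         (\<forall>x\<in>carrier S. \<forall>y\<in>carrier S. x \<otimes>\<^bsub>S\<^esub> y \<in> T \<longrightarrow> x \<in> T)}"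

definition convex_subsemigroups :: "('a, 'b) monoid_scheme \<Rightarrow> 'a set set" where
  "convex_subsemigroups S =
     {T. subsemigroup T S \<and>
         (\<forall>x\<in>carrier S. \<forall>y\<in>carrier S. x \<otimes>\<^bsub>S\<^esub> y \<in> T \<longrightarrow> x \<in> T \<and> y \<in> T)}"

text \<open>A subgroup of a semigroup may have any idempotent \<open>e\<close> as its identity, so the
  \<open>one\<close> field is replaced along with the carrier.\<close>

definition subgroup_with_identity :: "'a set \<Rightarrow> 'a \<Rightarrow> ('a, 'b) monoid_scheme \<Rightarrow> bool" where
  "subgroup_with_identity H e S \<longleftrightarrow>
     H \<subseteq> carrier S \<and> group (S\<lparr>carrier := H, one := e\<rparr>)"

definition maximal_subgroup :: "('a, 'b) monoid_scheme \<Rightarrow> 'a \<Rightarrow> 'a set" where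
  "maximal_subgroup S e = (GREATEST H. subgroup_with_identity H e S)"

text \<open>Maps of \<open>{1..n}\<close> to itself are represented by extensional functions, matching the
  library's \<open>Bij {1..n}\<close> for the symmetric group. The product \<open>f \<otimes> g\<close> applies \<open>f\<close> first.\<close>

definition full_transformation :: "nat \<Rightarrow> (nat \<Rightarrow> nat) monoid" where
  "full_transformation n =
     \<lparr>carrier = {1..n} \<rightarrow>\<^sub>E {1..n},
      mult = (\<lambda>f g. compose {1..n} g f),
      one = (\<lambda>x\<in>{1..n}. x)\<rparr>"

definition eps :: "nat \<Rightarrow> nat \<Rightarrow> nat \<Rightarrow> nat \<Rightarrow> nat" where
  "eps n m k = (\<lambda>x\<in>{1..n}. if x = k then m else x)"

definition Geps :: "nat \<Rightarrow> nat \<Rightarrow> nat \<Rightarrow> (nat \<Rightarrow> nat) set" where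
  "Geps n m k = maximal_subgroup (full_transformation n) (eps n m k)"

lemma monoid_full_transformation: "monoid (full_transformation n)"
proof
  fix x y z
  let ?T = "full_transformation n"
  assume x: "x \<in> carrier ?T"
  then show "\<one>\<^bsub>?T\<^esub> \<otimes>\<^bsub>?T\<^esub> x = x" "x \<otimes>\<^bsub>?T\<^esub> \<one>\<^bsub>?T\<^esub> = x"
    by (auto simp: full_transformation_def compose_def PiE_def extensional_def fun_eq_iff)
  assume y: "y \<in> carrier ?T"
  show "x \<otimes>\<^bsub>?T\<^esub> y \<in> carrier ?T"
    using x y by (auto simp: full_transformation_def compose_def)
  assume z: "z \<in> carrier ?T"
  show "x \<otimes>\<^bsub>?T\<^esub> y \<otimes>\<^bsub>?T\<^esub> z = x \<otimes>\<^bsub>?T\<^esub> (y \<otimes>\<^bsub>?T\<^esub> z)"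
    using x y z by (auto simp: full_transformation_def compose_def fun_eq_iff)
qed (auto simp: full_transformation_def)

text \<open>In particular the greatest subgroup with identity \<open>eps n m k\<close> exists.\<close>

lemma Geps_eq:
  assumes m: "m \<in> {1..n}" and k: "k \<in> {1..n}" and mk: "m \<noteq> k"
  shows "Geps n m k =
    {f \<in> carrier (full_transformation n). f m = f k \<and> bij_betw f ({1..n} - {k}) ({1..n} - {k})}"
proof -
  define N where "N = {1..n}"
  let ?T = "full_transformation n"
  let ?e = "eps n m k"
  let ?H = "{f \<in> carrier ?T. f m = f k \<and> bij_betw f (N - {k}) (N - {k})}"
  have mN: "m \<in> N" and kN: "k \<in> N" using m k by (auto simp: N_def)
  have fin: "finite N" by (simp add: N_def)
  have car: "carrier ?T = N \<rightarrow>\<^sub>E N" by (simp add: full_transformation_def N_def)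
  have mult: "f \<otimes>\<^bsub>?T\<^esub> g = (\<lambda>x\<in>N. g (f x))" for f g
    by (simp add: full_transformation_def N_def compose_def)
  have e: "?e = (\<lambda>x\<in>N. if x = k then m else x)" by (simp add: eps_def N_def)
  have eH: "?e \<in> ?H"
  proof -
    have "bij_betw ?e (N - {k}) (N - {k}) = bij_betw id (N - {k}) (N - {k})"
      by (rule bij_betw_cong) (auto simp: e)
    then show ?thesis using mN kN mk by (auto simp: e car)
  qed
  have closed: "f \<otimes>\<^bsub>?T\<^esub> g \<in> ?H" if f: "f \<in> ?H" and g: "g \<in> ?H" for f g
  proof -
    have fN: "f x \<in> N" if "x \<in> N" for x using f that by (auto simp: car)
    have gN: "g x \<in> N" if "x \<in> N" for x using g that by (auto simp: car)
    have "bij_betw (g \<circ> f) (N - {k}) (N - {k})" using f g by (auto intro: bij_betw_trans)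
    moreover have "bij_betw (g \<circ> f) (N - {k}) (N - {k})
        = bij_betw (\<lambda>x\<in>N. g (f x)) (N - {k}) (N - {k})"
      by (rule bij_betw_cong) auto
    ultimately show ?thesis using f g fN gN mN kN by (auto simp: mult car)
  qed
  have l_one: "?e \<otimes>\<^bsub>?T\<^esub> f = f" if f: "f \<in> ?H" for f
    using f by (auto simp: mult e car fun_eq_iff PiE_def extensional_def)
  have l_inv: "\<exists>y\<in>?H. y \<otimes>\<^bsub>?T\<^esub> f = ?e" if f: "f \<in> ?H" for f
  proof -
    have b: "bij_betw f (N - {k}) (N - {k})" using f by auto
    define g where "g = inv_into (N - {k}) f"
    have gb: "bij_betw g (N - {k}) (N - {k})" unfolding g_def by (rule bij_betw_inv_into[OF b])
    have fg: "f (g x) = x" if "x \<in> N - {k}" for x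
      unfolding g_def using b that by (rule bij_betw_inv_into_right)
    have gN: "g x \<in> N" if "x \<in> N - {k}" for x using gb that by (auto simp: bij_betw_def)
    let ?y = "\<lambda>x\<in>N. g (if x = k then m else x)"
    have "bij_betw ?y (N - {k}) (N - {k}) = bij_betw g (N - {k}) (N - {k})"
      by (rule bij_betw_cong) auto
    then have "?y \<in> ?H" using gb gN mN kN mk by (auto simp: car)
    moreover have "?y \<otimes>\<^bsub>?T\<^esub> f = ?e" using fg mN mk by (auto simp: mult e fun_eq_iff)
    ultimately show ?thesis by blast
  qed
  interpret T: Group.monoid ?T by (rule monoid_full_transformation)
  have grp: "Group.group (?T\<lparr>carrier := ?H, one := ?e\<rparr>)"
  proof (rule groupI, goal_cases)
    case (1 x y)
    then show ?case using closed[of x y] by simp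
  next
    case 2
    then show ?case using eH by simp
  next
    case (3 x y z)
    then show ?case using T.m_assoc[of x y z] by simp
  next
    case (4 x)
    then show ?case using l_one[of x] by simp
  next
    case (5 x)
    then show ?case using l_inv[of x] by simp
  qed
  have "(GREATEST H. subgroup_with_identity H ?e ?T) = ?H"
  proof (rule Greatest_equality)
    show "subgroup_with_identity ?H ?e ?T"
      using grp by (auto simp: subgroup_with_identity_def)
  next
    fix K assume "subgroup_with_identity K ?e ?T"
    then have Kc: "K \<subseteq> carrier ?T" and G: "group (?T\<lparr>carrier := K, one := ?e\<rparr>)"
      by (auto simp: subgroup_with_identity_def)
    interpret G: group "?T\<lparr>carrier := K, one := ?e\<rparr>" by (rule G)
    show "K \<subseteq> ?H"
    proof
      fix f assume f: "f \<in> K"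
      have fc: "f \<in> N \<rightarrow>\<^sub>E N" using f Kc by (auto simp: car)
      have l: "?e \<otimes>\<^bsub>?T\<^esub> f = f" and r: "f \<otimes>\<^bsub>?T\<^esub> ?e = f"
        using G.l_one[of f] G.r_one[of f] f by simp_all
      obtain g where g: "f \<otimes>\<^bsub>?T\<^esub> g = ?e" using G.r_inv_ex[of f] f by auto
      have fk: "f m = f k" using fun_cong[OF l, of k] kN by (auto simp: mult e)
      have nk: "f x \<in> N - {k}" if "x \<in> N" for x
        using fun_cong[OF r, of x] that PiE_mem[OF fc that] mk
        by (auto simp: mult e split: if_splits)
      have gf: "g (f x) = x" if "x \<in> N - {k}" for x
        using fun_cong[OF g, of x] that by (auto simp: mult e)
      have inj: "inj_on f (N - {k})" by (rule inj_on_inverseI[where g = g]) (rule gf)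
      have "f ` (N - {k}) = N - {k}"
        by (rule endo_inj_surj) (use fin nk inj in auto)
      then show "f \<in> ?H" using fc fk inj by (auto simp: car bij_betw_def)
    qed
  qed
  then show ?thesis unfolding Geps_def maximal_subgroup_def N_def .
qed

end

theory Submission
  imports Defs "HOL-Combinatorics.Transposition"
begin

text \<open>
  Every transformation has an idempotent power, so an isolated subsemigroup \<open>T\<close> is determined
  by its idempotents. If an idempotent \<open>e \<in> T\<close> moves two points \<open>a \<noteq> b\<close>, then \<open>T\<close> also contains
  the idempotent that fixes \<open>a\<close> and agrees with \<open>e\<close> elsewhere, because the latter is a product
  of two square roots of \<open>e\<close>; repeating this gives \<open>\<epsilon>\<^bsub>e(b),b\<^esub> \<in> T\<close> for every moved \<open>b\<close>.
  Multiplying with elements of the groups of these idempotents lowers the rank down to a constant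
  map, whence \<open>T\<close> contains all \<open>\<epsilon>\<^bsub>m,k\<^esub>\<close> and thus all singular maps. Otherwise every idempotent of
  \<open>T\<close> is the identity or some \<open>\<epsilon>\<^bsub>m,k\<^esub>\<close>; in the absence of the identity \<open>T\<close> is the union of the
  groups of these, and two of them can occur together only if neither of their products
  moves two points.
\<close>

section \<open>Idempotent powers and group elements\<close>

definition idem_on :: "'a set \<Rightarrow> ('a \<Rightarrow> 'a) \<Rightarrow> bool" where
  "idem_on N e \<longleftrightarrow> e \<in> N \<rightarrow> N \<and> (\<forall>x\<in>N. e (e x) = e x)"

lemma funpow_Pi: "f \<in> N \<rightarrow> N \<Longrightarrow> f ^^ j \<in> N \<rightarrow> N"
  by (induction j) auto

lemma funpow_cong_on:
  assumes "f \<in> N \<rightarrow> N" "\<And>x. x \<in> N \<Longrightarrow> f x = g x" "x \<in> N"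
  shows "(f ^^ j) x = (g ^^ j) x"
proof (induction j)
  case (Suc j)
  have "f ((f ^^ j) x) = g ((f ^^ j) x)"
    by (rule assms(2)) (use funpow_Pi[OF assms(1), of j] assms(3) in auto)
  with Suc show ?case by simp
qed auto

text \<open>There are only finitely many self-maps of \<open>N\<close>, so two powers of
  \<open>f\<close> agree on \<open>N\<close>, and from some exponent \<open>p\<close> on the powers
  are periodic with a period \<open>d\<close>. A power whose exponent is at least \<open>p\<close>
  and a multiple of \<open>d\<close> is then idempotent.\<close>

lemma ex_idem_power:
  assumes fin: "finite N" and f: "f \<in> N \<rightarrow> N"
  obtains j where "j > 0" "idem_on N (f ^^ j)"
proof -
  have "range (\<lambda>i. restrict (f ^^ i) N) \<subseteq> N \<rightarrow>\<^sub>E N"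
    using funpow_Pi[OF f] by (simp add: image_subset_iff restrict_PiE_iff Pi_iff)
  then have "finite (range (\<lambda>i. restrict (f ^^ i) N))"
    by (rule finite_subset) (use fin in \<open>auto intro: finite_PiE\<close>)
  then have "\<not> inj (\<lambda>i. restrict (f ^^ i) N)"
    using finite_imageD by blast
  then obtain p q where "p \<noteq> q" and eq: "restrict (f ^^ p) N = restrict (f ^^ q) N"
    by (auto simp: inj_def)
  then have "\<exists>p d. d > 0 \<and> (\<forall>x\<in>N. (f ^^ (p + d)) x = (f ^^ p) x)"
  proof (induction p q rule: linorder_wlog)
    case (le p q)
    then have "q = p + (q - p)" "q - p > 0" by auto
    moreover have "(f ^^ q) x = (f ^^ p) x" if "x \<in> N" for x
      using fun_cong[OF le(3), of x] that by simp
    ultimately show ?case by metis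
  next
    case (sym p q)
    then show ?case by metis
  qed
  then obtain p d where d: "d > 0" and per: "\<And>x. x \<in> N \<Longrightarrow> (f ^^ (p + d)) x = (f ^^ p) x"
    by blast
  have step: "(f ^^ (m + d)) x = (f ^^ m) x" if "m \<ge> p" "x \<in> N" for m x
  proof -
    have "(f ^^ (m + d)) x = (f ^^ (m - p)) ((f ^^ (p + d)) x)"
      using that by (simp flip: funpow_add comp_apply[of "f ^^ (m - p)" "f ^^ (p + d)"])
    also have "\<dots> = (f ^^ m) x"
      using that per by (simp flip: funpow_add comp_apply[of "f ^^ (m - p)" "f ^^ p"])
    finally show ?thesis .
  qed
  have steps: "(f ^^ (m + t * d)) x = (f ^^ m) x" if "m \<ge> p" "x \<in> N" for m t x
  proof (induction t)
    case (Suc t)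
    then show ?case using step[of "m + t * d" x] that by (simp add: algebra_simps)
  qed auto
  \<comment> \<open>The factor \<open>Suc p\<close> rather than \<open>p\<close> keeps the exponent
    positive when \<open>p = 0\<close>.\<close>
  define j where "j = Suc p * d"
  have "j \<ge> p" using d unfolding j_def by (metis Suc_leD le_refl mult_le_mono nat_mult_1_right One_nat_def Suc_leI)
  then have "(f ^^ j) ((f ^^ j) x) = (f ^^ j) x" if "x \<in> N" for x
    using steps[of j x "Suc p"] that by (metis comp_apply funpow_add j_def)
  then have "idem_on N (f ^^ j)" using funpow_Pi[OF f] by (simp add: idem_on_def)
  moreover have "j > 0" using d by (simp add: j_def)
  ultimately show thesis by (rule that[rotated])
qed

lemma idem_on_inj:
  assumes "idem_on N e" "inj_on e N" "x \<in> N"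
  shows "e x = x"
  using assms unfolding idem_on_def inj_on_def by (metis PiE Pi_mem)

text \<open>An idempotent that moves \<open>a\<close> never takes the value \<open>a\<close> on
  \<open>N\<close>, so no other point is affected when \<open>a\<close> becomes fixed.\<close>

lemma idem_on_upd_fixed:
  assumes "idem_on N e" "e a \<noteq> a"
  shows "idem_on N (e(a := a))"
  using assms unfolding idem_on_def by auto

lemma inj_on_funpow:
  assumes "f \<in> N \<rightarrow> N" "inj_on f N"
  shows "inj_on (f ^^ j) N"
proof (induction j)
  case (Suc j)
  have "inj_on f ((f ^^ j) ` N)"
    using assms funpow_Pi[OF assms(1), of j] by (auto intro: inj_on_subset)
  with Suc show ?case unfolding funpow.simps(2) by (intro comp_inj_on)
qed auto

lemma inj_on_funpowD:
  fixes f :: "'a \<Rightarrow> 'a"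
  assumes "inj_on (f ^^ j) N" "j > 0"
  shows "inj_on f N"
proof -
  obtain i where "j = Suc i" using assms(2) by (cases j) auto
  then have "f ^^ j = (f ^^ i) \<circ> f" by (simp only: funpow_Suc_right)
  then show ?thesis using assms(1) by (auto dest: inj_on_imageI2)
qed

lemma transpose_mem: "x \<in> N \<Longrightarrow> a \<in> N \<Longrightarrow> b \<in> N \<Longrightarrow> transpose a b x \<in> N"
  by (simp add: transpose_def)

text \<open>The non-trivial part of membership in \<open>G(\<epsilon>\<^bsub>m,k\<^esub>)\<close>; the idempotent \<open>\<epsilon>\<^bsub>m,k\<^esub>\<close> itself
  appears below as \<open>id(k := m)\<close>.\<close>

definition in_group :: "'a set \<Rightarrow> 'a \<Rightarrow> 'a \<Rightarrow> ('a \<Rightarrow> 'a) \<Rightarrow> bool" where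
  "in_group N m k f \<longleftrightarrow> f m = f k \<and> bij_betw f (N - {k}) (N - {k})"

lemma in_group_image:
  assumes "in_group N m k f" "m \<in> N" "k \<in> N" "m \<noteq> k"
  shows "f ` N = N - {k}"
proof -
  have img: "f ` (N - {k}) = N - {k}" and eq: "f k = f m"
    using assms by (simp_all add: in_group_def bij_betw_def)
  have "f ` N = insert (f m) (f ` (N - {k}))"
    using assms(3) eq by (metis image_insert insert_Diff)
  also have "\<dots> = f ` (N - {k})" using assms by blast
  also note img
  finally show ?thesis .
qed

text \<open>This makes the groups isolated. A non-injective power forces \<open>f\<close> to be
  non-injective, so its image is a proper subset of \<open>N\<close>; it contains the image
  \<open>N - {k}\<close> of the power and hence equals it. Thus \<open>f\<close> permutes
  \<open>N - {k}\<close>, and cancelling the remaining \<open>j - 1\<close> factors there gives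
  \<open>f m = f k\<close>.\<close>

lemma in_group_root:
  assumes fin: "finite N" and f: "f \<in> N \<rightarrow> N" and N: "m \<in> N" "k \<in> N" "m \<noteq> k"
    and j: "j > 0" and g: "in_group N m k (f ^^ j)"
  shows "in_group N m k f"
proof -
  obtain i where i: "j = Suc i" using j by (cases j) auto
  have "\<not> inj_on (f ^^ j) N" using g N by (auto simp: in_group_def inj_on_def)
  then have ninj: "\<not> inj_on f N" using inj_on_funpow[OF f] by blast
  then have neq: "f ` N \<noteq> N" using fin by (metis finite_surj_inj subset_refl)
  have "(f ^^ j) ` N = f ` ((f ^^ i) ` N)" by (simp add: i image_comp)
  also have "\<dots> \<subseteq> f ` N" using funpow_Pi[OF f] by auto
  finally have "N - {k} \<subseteq> f ` N" using in_group_image[OF g N] by simp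
  moreover have "f ` N \<subseteq> N" using f by auto
  ultimately have img: "f ` N = N - {k}" using neq by auto
  have inj: "inj_on f (N - {k})"
    using g j by (auto simp: in_group_def bij_betw_def intro: inj_on_funpowD)
  have maps: "f \<in> (N - {k}) \<rightarrow> (N - {k})" using img by blast
  have "f ` (N - {k}) = N - {k}"
    by (rule endo_inj_surj) (use fin maps inj in auto)
  moreover have "f m = f k"
  proof -
    have "(f ^^ i) (f m) = (f ^^ i) (f k)"
      using g by (simp add: in_group_def i funpow_Suc_right del: funpow.simps)
    moreover have "inj_on (f ^^ i) (N - {k})" by (rule inj_on_funpow[OF maps inj])
    moreover have "f m \<in> N - {k}" "f k \<in> N - {k}" using img N by auto
    ultimately show ?thesis by (auto dest: inj_onD)
  qed
  ultimately show ?thesis using inj by (simp add: in_group_def bij_betw_def)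
qed

lemma in_group_funpow:
  assumes "in_group N m k f" "j > 0"
  shows "in_group N m k (f ^^ j)"
proof -
  obtain i where "j = Suc i" using assms(2) by (cases j) auto
  then have "(f ^^ j) m = (f ^^ j) k"
    using assms(1) by (simp add: in_group_def funpow_Suc_right del: funpow.simps)
  moreover have "bij_betw (f ^^ j) (N - {k}) (N - {k})"
    using assms(1) by (auto simp: in_group_def intro: bij_betw_funpow)
  ultimately show ?thesis by (simp add: in_group_def)
qed

lemma in_group_cong:
  assumes "in_group N m k f" "\<And>x. x \<in> N \<Longrightarrow> f x = g x" "m \<in> N" "k \<in> N"
  shows "in_group N m k g"
proof -
  have "bij_betw f (N - {k}) (N - {k}) = bij_betw g (N - {k}) (N - {k})"
    by (rule bij_betw_cong) (use assms in auto)
  then show ?thesis using assms unfolding in_group_def by metis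
qed

lemma in_group_eps:
  assumes "m \<noteq> k"
  shows "in_group N m k (id(k := m))"
proof -
  have "bij_betw (id(k := m)) (N - {k}) (N - {k}) = bij_betw id (N - {k}) (N - {k})"
    by (rule bij_betw_cong) auto
  then show ?thesis using assms by (simp add: in_group_def)
qed

text \<open>An idempotent permutation of \<open>N - {k}\<close> is the identity, and the value at
  \<open>k\<close> is forced by \<open>e k = e m\<close>.\<close>

lemma in_group_idem:
  assumes "in_group N m k e" "idem_on N e" "m \<in> N" "k \<in> N" "m \<noteq> k" "x \<in> N"
  shows "e x = (id(k := m)) x"
proof -
  have "e \<in> N \<rightarrow> N - {k}" using in_group_image[OF assms(1,3-5)] by blast
  then have idem: "idem_on (N - {k}) e" using assms unfolding idem_on_def by auto
  have fixed: "e y = y" if "y \<in> N - {k}" for y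
    by (rule idem_on_inj[OF idem _ that]) (use assms in \<open>auto simp: in_group_def bij_betw_def\<close>)
  have "e k = e m" using assms by (simp add: in_group_def)
  then show ?thesis using fixed[of x] fixed[of m] assms by auto
qed

section \<open>Isolated semigroups of transformations\<close>

text \<open>Isolation over an arbitrary finite set, phrased without the monoid record. Non-emptiness
  of \<open>T\<close> is added separately in \<open>isolated_iff\<close>.\<close>

locale isolated_transformations =
  fixes N :: "'a set" and T :: "('a \<Rightarrow> 'a) set"
  assumes fin: "finite N"
    and sub: "T \<subseteq> N \<rightarrow>\<^sub>E N"
    and mult: "f \<in> T \<Longrightarrow> g \<in> T \<Longrightarrow> compose N g f \<in> T"
    and root: "f \<in> N \<rightarrow>\<^sub>E N \<Longrightarrow> j > 0 \<Longrightarrow> restrict (f ^^ j) N \<in> T \<Longrightarrow> f \<in> T"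
begin

text \<open>Total functions stand for the members of \<open>T\<close>, their values outside \<open>N\<close> being irrelevant.
  This replaces \<open>compose N\<close> and the restricted powers by \<open>\<circ>\<close> and \<open>^^\<close>.\<close>

definition has :: "('a \<Rightarrow> 'a) \<Rightarrow> bool" where
  "has f \<longleftrightarrow> f \<in> N \<rightarrow> N \<and> restrict f N \<in> T"

lemma has_Pi: "has f \<Longrightarrow> f \<in> N \<rightarrow> N"
  by (simp add: has_def)

lemma mem_iff_has: "f \<in> N \<rightarrow>\<^sub>E N \<Longrightarrow> f \<in> T \<longleftrightarrow> has f"
  by (auto simp: has_def PiE_restrict)

lemma has_cong:
  assumes "has f" "\<And>x. x \<in> N \<Longrightarrow> f x = g x"
  shows "has g"
proof -
  have "restrict f N = restrict g N" using assms by auto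
  moreover have "g \<in> N \<rightarrow> N" using assms by (simp add: has_def Pi_iff)
  ultimately show ?thesis using assms(1) by (simp add: has_def)
qed

lemma has_comp:
  assumes "has f" "has g"
  shows "has (g \<circ> f)"
proof -
  have "compose N (restrict g N) (restrict f N) = restrict (g \<circ> f) N"
    using has_Pi[OF assms(1)] by (auto simp: compose_def fun_eq_iff)
  then show ?thesis using assms mult[of "restrict f N" "restrict g N"] by (auto simp: has_def)
qed

lemma has_root:
  assumes f: "f \<in> N \<rightarrow> N" and "j > 0" "has (f ^^ j)"
  shows "has f"
proof -
  have "restrict (restrict f N ^^ j) N = restrict (f ^^ j) N"
    using funpow_cong_on[OF f, of "restrict f N"] by (auto simp: fun_eq_iff)
  then show ?thesis using assms root[of "restrict f N" j] by (auto simp: has_def)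
qed

lemma has_funpow: "has f \<Longrightarrow> j > 0 \<Longrightarrow> has (f ^^ j)"
proof (induction j)
  case (Suc j)
  show ?case
  proof (cases "j = 0")
    case True
    then show ?thesis using Suc.prems by simp
  next
    case False
    then have "has (f \<circ> f ^^ j)" using Suc by (intro has_comp) auto
    then show ?thesis unfolding funpow.simps(2) .
  qed
qed auto

section \<open>Idempotents and group elements in an isolated semigroup\<close>

lemma has_fix_point:
  assumes e: "has e" "idem_on N e" and ab: "a \<in> N" "b \<in> N" "a \<noteq> b" "e a \<noteq> a" "e b \<noteq> b"
  shows "has (e(a := a))"
proof -
  \<comment> \<open>Both \<open>(s \<circ> e)(a := b)\<close> and \<open>(s \<circ> e)(b := a)\<close> square to \<open>e\<close>.\<close>
  define s where "s = transpose (e a) (e b)"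
  have eN: "e x \<in> N" "e (e x) = e x" if "x \<in> N" for x
    using e(2) that by (auto simp: idem_on_def)
  have se: "s (e x) \<in> N" "e (s (e x)) = s (e x)" "s (e x) \<noteq> a" "s (e x) \<noteq> b" if "x \<in> N" for x
    using that eN ab by (auto simp: s_def transpose_def)
  have ss [simp]: "s (s x) = x" for x by (simp add: s_def)
  have s_ab [simp]: "s (e a) = e b" "s (e b) = e a" by (auto simp: s_def)
  have root: "has ((s \<circ> e)(u := v))"
    if uv: "u \<in> N" "v \<in> N" "u \<noteq> v" "{u, v} = {a, b}" for u v
  proof (rule has_root)
    show "(s \<circ> e)(u := v) \<in> N \<rightarrow> N" using se uv by auto
    \<comment> \<open>The point \<open>u\<close> goes to \<open>v\<close> and then to
      \<open>s (e v) = e u\<close>. Every other point goes to \<open>s (e x)\<close>, which is a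
      fixed point of \<open>e\<close> different from \<open>u\<close>, and the second application of
      \<open>s\<close> undoes the first.\<close>
    have "e x = (((s \<circ> e)(u := v)) ^^ 2) x" if "x \<in> N" for x
      using se[OF that] uv ab by (auto simp: numeral_2_eq_2 doubleton_eq_iff)
    with e(1) show "has (((s \<circ> e)(u := v)) ^^ 2)" by (rule has_cong)
  qed simp
  \<comment> \<open>Under this product \<open>a\<close> goes to \<open>b\<close> and back to
    \<open>a\<close>, while every other point, including \<open>b\<close>, passes through
    \<open>s\<close> twice and ends at its value under \<open>e\<close>.\<close>
  have "has ((s \<circ> e)(b := a) \<circ> (s \<circ> e)(a := b))"
    by (intro has_comp root) (use ab in auto)
  then show ?thesis
  proof (rule has_cong)
    fix x assume "x \<in> N"
    then show "((s \<circ> e)(b := a) \<circ> (s \<circ> e)(a := b)) x = (e(a := a)) x"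
      using se[of x] se[of b] ab by (cases "x = a"; cases "x = b") auto
  qed
qed

text \<open>Induction on the number of moved points: \<open>has_fix_point\<close> turns the moved
  points other than \<open>b\<close> into fixed points one at a time, without changing the value at
  \<open>b\<close>.\<close>

lemma has_eps_of_idem:
  assumes "has e" "idem_on N e" "b \<in> N" "e b \<noteq> b"
  shows "has (id(b := e b))"
  using assms
proof (induction "card {x \<in> N. e x \<noteq> x}" arbitrary: e rule: less_induct)
  case less
  show ?case
  proof (cases "\<exists>a\<in>N. a \<noteq> b \<and> e a \<noteq> a")
    case True
    then obtain a where a: "a \<in> N" "a \<noteq> b" "e a \<noteq> a" by blast
    let ?e = "e(a := a)"
    have "card {x \<in> N. ?e x \<noteq> x} < card {x \<in> N. e x \<noteq> x}"
      by (rule psubset_card_mono) (use fin a in auto)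
    moreover have "has ?e" by (rule has_fix_point) (use less.prems a in auto)
    moreover have "idem_on N ?e" using less.prems a by (intro idem_on_upd_fixed)
    ultimately have "has (id(b := ?e b))" using less.hyps[of ?e] less.prems a by auto
    then show ?thesis using a by simp
  next
    case False
    then show ?thesis by (intro has_cong[OF less.prems(1)]) auto
  qed
qed

text \<open>An idempotent \<open>e\<close> moving \<open>b\<close> is \<open>id(b := e b)\<close>
  followed by \<open>e(b := b)\<close>, which moves one point less; so by induction all non-identity
  idempotents are present. Every non-injective map has such an idempotent as a power.\<close>

lemma has_noninj_if_all_eps:
  assumes all: "\<And>m k. m \<in> N \<Longrightarrow> k \<in> N \<Longrightarrow> m \<noteq> k \<Longrightarrow> has (id(k := m))"
    and f: "f \<in> N \<rightarrow> N" "\<not> inj_on f N"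
  shows "has f"
proof -
  have idem: "has e" if "idem_on N e" "b \<in> N" "e b \<noteq> b" for e b
    using that
  proof (induction "card {x \<in> N. e x \<noteq> x}" arbitrary: e b rule: less_induct)
    case less
    have eb: "e b \<in> N" "e (e b) = e b" using less.prems by (auto simp: idem_on_def)
    have eps: "has (id(b := e b))" using all eb less.prems by auto
    show ?case
    proof (cases "\<exists>a\<in>N. a \<noteq> b \<and> e a \<noteq> a")
      case True
      then obtain a where a: "a \<in> N" "a \<noteq> b" "e a \<noteq> a" by blast
      let ?e = "e(b := b)"
      have "card {x \<in> N. ?e x \<noteq> x} < card {x \<in> N. e x \<noteq> x}"
        by (rule psubset_card_mono) (use fin a less.prems in auto)
      moreover have "idem_on N ?e" using less.prems by (intro idem_on_upd_fixed)
      ultimately have "has ?e" using less.hyps[of ?e a] a by auto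
      then have "has (?e \<circ> id(b := e b))" by (rule has_comp[OF eps])
      then show ?thesis by (rule has_cong) (use eb less.prems in auto)
    next
      case False
      then show ?thesis by (intro has_cong[OF eps]) auto
    qed
  qed
  obtain j where j: "j > 0" "idem_on N (f ^^ j)" using ex_idem_power[OF fin f(1)] .
  have "\<exists>b\<in>N. (f ^^ j) b \<noteq> b"
    using f(2) inj_on_funpowD[OF _ j(1)] by (metis inj_on_id2 inj_on_cong)
  then have "has (f ^^ j)" using idem j by blast
  then show ?thesis using has_root f j by blast
qed

text \<open>The idempotent power of \<open>f\<close> lies in the same group, hence agrees on
  \<open>N\<close> with its identity \<open>id(k := m)\<close>, and \<open>f\<close> is a root of
  that.\<close>

lemma has_in_group:
  assumes "has (id(k := m))" "m \<in> N" "k \<in> N" "m \<noteq> k" "f \<in> N \<rightarrow> N" "in_group N m k f"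
  shows "has f"
proof -
  obtain j where j: "j > 0" "idem_on N (f ^^ j)" using ex_idem_power[OF fin assms(5)] .
  have "has (f ^^ j)"
    using in_group_idem[OF in_group_funpow[OF assms(6) j(1)] j(2)] assms
    by (intro has_cong[OF assms(1)]) auto
  then show ?thesis using has_root assms j by blast
qed

text \<open>The idempotent power of a permutation is the identity. So one permutation brings the
  identity into \<open>T\<close>, and all other permutations are roots of it.\<close>

lemma has_bij:
  assumes "has f" "inj_on f N" "g \<in> N \<rightarrow> N" "inj_on g N"
  shows "has g"
proof -
  obtain i where i: "i > 0" "idem_on N (f ^^ i)" using ex_idem_power[OF fin has_Pi[OF assms(1)]] .
  obtain j where j: "j > 0" "idem_on N (g ^^ j)" using ex_idem_power[OF fin assms(3)] .
  have "(f ^^ i) x = (g ^^ j) x" if "x \<in> N" for x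
    using idem_on_inj[OF i(2) inj_on_funpow[OF has_Pi[OF assms(1)] assms(2)] that]
      idem_on_inj[OF j(2) inj_on_funpow[OF assms(3,4)] that] by simp
  then have "has (g ^^ j)" by (rule has_cong[OF has_funpow[OF assms(1) i(1)]])
  then show ?thesis using has_root assms j by blast
qed

text \<open>The exponent is exported because \<open>in_group_root\<close> later passes from
  \<open>e\<close> back to \<open>f\<close>.\<close>

lemma ex_idem_not_fixed:
  assumes "has f" "\<not> inj_on f N"
  obtains e b and j :: nat where "has e" "idem_on N e" "b \<in> N" "e b \<noteq> b" "j > 0" "e = f ^^ j"
proof -
  obtain j where j: "j > 0" "idem_on N (f ^^ j)" using ex_idem_power[OF fin has_Pi[OF assms(1)]] .
  moreover have "\<exists>b\<in>N. (f ^^ j) b \<noteq> b"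
    using assms(2) inj_on_funpowD[OF _ j(1)] by (metis inj_on_id2 inj_on_cong)
  ultimately show thesis using that has_funpow[OF assms(1) j(1)] by blast
qed

text \<open>All permutations are available, and some \<open>id(b := m0)\<close> as well. Conjugation
  by transpositions carries the pair \<open>(m0, b)\<close> to any pair of distinct points.\<close>

lemma has_all:
  assumes f: "has f" "inj_on f N" and g: "has g" "\<not> inj_on g N" and h: "h \<in> N \<rightarrow> N"
  shows "has h"
proof -
  have transp: "has (transpose x y)" if "x \<in> N" "y \<in> N" for x y
    by (rule has_bij[OF f]) (use that in \<open>auto simp: transpose_mem\<close>)
  have conj: "has (id(transpose x y k := transpose x y m))"
    if "has (id(k := m))" "x \<in> N" "y \<in> N" for x y k m
  proof -
    have "has (transpose x y \<circ> (id(k := m) \<circ> transpose x y))"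
      by (intro has_comp transp that)
    then show ?thesis by (rule has_cong) auto
  qed
  obtain e b j where e: "has e" "idem_on N e" "b \<in> N" "e b \<noteq> b"
    using ex_idem_not_fixed[OF g] .
  define m0 where "m0 = e b"
  have m0: "m0 \<in> N" "m0 \<noteq> b" "has (id(b := m0))"
    using e has_eps_of_idem[OF e] by (auto simp: m0_def idem_on_def)
  have "has (id(k := m))" if mk: "m \<in> N" "k \<in> N" "m \<noteq> k" for m k
  proof -
    \<comment> \<open>The first conjugation moves \<open>b\<close> to \<open>k\<close> and thereby
      \<open>m0\<close> to \<open>m'\<close>. The second one exchanges \<open>m'\<close> with
      \<open>m\<close> and leaves \<open>k\<close> in place.\<close>
    define m' where "m' = transpose b k m0"
    have m': "m' \<in> N" "m' \<noteq> k" using m0 mk e by (auto simp: m'_def transpose_def)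
    have "has (id(k := m'))" using conj[OF m0(3) e(3) mk(2)] by (simp add: m'_def)
    from conj[OF this m'(1) mk(1)] show ?thesis using m' mk by simp
  qed
  from has_noninj_if_all_eps[OF this h] show ?thesis using has_bij[OF f h] by blast
qed

section \<open>Lowering the rank to a constant map\<close>

text \<open>A constant map is an idempotent moving every point but its value, so it yields all
  \<open>id(k := c)\<close>. Their groups contain maps sending \<open>c\<close> to any other
  \<open>d\<close>; hence all constant maps are present, and with them all
  \<open>id(k := d)\<close>.\<close>

lemma has_noninj_if_const:
  assumes c: "c \<in> N" "has (\<lambda>_. c)" and N: "card N > 2" and f: "f \<in> N \<rightarrow> N" "\<not> inj_on f N"
  shows "has f"
proof -
  have eps: "has (id(k := d))" if "d \<in> N" "has (\<lambda>_. d)" "k \<in> N" "d \<noteq> k" for d k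
    using has_eps_of_idem[of "\<lambda>_. d" k] that by (auto simp: idem_on_def)
  have const: "has (\<lambda>_. d)" if d: "d \<in> N" for d
  proof (cases "d = c")
    case False
    \<comment> \<open>A third point \<open>k\<close> is needed as the collapsed point, so that the
      transposition of \<open>c\<close> and \<open>d\<close> permutes
      \<open>N - {k}\<close>.\<close>
    have "card {c, d} < card N" using N False by simp
    then have "\<not> N \<subseteq> {c, d}" using card_mono[of "{c, d}" N] by auto
    then obtain k where k: "k \<in> N" "k \<noteq> c" "k \<noteq> d" by blast
    define g where "g = transpose c d \<circ> id(k := c)"
    have "bij_betw (transpose c d) (N - {k}) (N - {k})"
      by (rule bij_betw_byWitness[where f' = "transpose c d"])
        (use c d k in \<open>auto simp: transpose_def\<close>)
    then have "in_group N c k g" using in_group_eps[of c k N] k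
      by (auto simp: in_group_def g_def intro: bij_betw_trans)
    then have "has g"
      by (intro has_in_group[OF eps[OF c k(1)]]) (use c d k in \<open>auto simp: g_def transpose_mem\<close>)
    from has_comp[OF c(2) this] show ?thesis
      by (rule has_cong) (use k in \<open>auto simp: g_def\<close>)
  qed (use c in auto)
  show ?thesis by (rule has_noninj_if_all_eps[OF _ f]) (use eps const in auto)
qed

text \<open>Let \<open>e\<close> be an idempotent power of a member of minimal rank. If its image
  had two points, an element \<open>g\<close> of the group of some \<open>id(a := e a)\<close> would
  send them to points that \<open>e\<close> identifies, and \<open>e \<circ> (g \<circ> e)\<close>
  would have smaller rank. So \<open>e\<close> is constant on \<open>N\<close>, and
  \<open>has_noninj_if_const\<close> applies.\<close>

lemma has_noninj_if_two_not_fixed: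
  assumes e0: "has e0" "idem_on N e0"
    and ab: "a0 \<in> N" "b0 \<in> N" "a0 \<noteq> b0" "e0 a0 \<noteq> a0" "e0 b0 \<noteq> b0"
    and f: "f \<in> N \<rightarrow> N" "\<not> inj_on f N"
  shows "has f"
proof -
  define r where "r = (\<lambda>f :: 'a \<Rightarrow> 'a. card (f ` N))"
  obtain h where h: "has h" "\<And>g. has g \<Longrightarrow> r h \<le> r g"
    using ex_has_least_nat[of has e0 r] e0(1) by blast
  obtain j where j: "j > 0" "idem_on N (h ^^ j)" using ex_idem_power[OF fin has_Pi[OF h(1)]] .
  define e where "e = h ^^ j"
  have e: "has e" "idem_on N e" using has_funpow[OF h(1) j(1)] j(2) by (auto simp: e_def)
  have eN: "e x \<in> N" "e (e x) = e x" if "x \<in> N" for x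
    using e(2) that by (auto simp: idem_on_def)
  have "r e \<le> r h"
  proof -
    obtain i where "j = Suc i" using j(1) by (cases j) auto
    then have "e ` N = h ` ((h ^^ i) ` N)" by (simp add: e_def image_comp)
    also have "\<dots> \<subseteq> h ` N" using funpow_Pi[OF has_Pi[OF h(1)]] by auto
    finally show ?thesis unfolding r_def using fin by (intro card_mono) auto
  qed
  with h(2) have min: "r e \<le> r g" if "has g" for g using that by (meson le_trans)
  have "e0 x \<in> N - {a0, b0}" if "x \<in> N" for x
  proof -
    have "e0 x \<in> N" "e0 (e0 x) = e0 x" using e0(2) that by (auto simp: idem_on_def)
    then show ?thesis using ab(4,5) by force
  qed
  then have "e0 ` N \<subseteq> N - {a0, b0}" by blast
  then have "r e0 \<le> card (N - {a0, b0})" unfolding r_def using fin by (intro card_mono) auto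
  also have "\<dots> = card N - 2" using ab fin by (simp add: card_Diff_subset)
  finally have re: "r e \<le> card N - 2" using min[OF e0(1)] by simp
  have two: "2 \<le> card N" using card_mono[OF fin, of "{a0, b0}"] ab by simp
  have "card (N - e ` N) = card N - r e"
    unfolding r_def using eN fin by (intro card_Diff_subset) auto
  then have "2 \<le> card (N - e ` N)" using re two by linarith
  \<comment> \<open>Two points outside the image are needed: \<open>a\<close> is the point that
    \<open>g\<close> may not take as a value, and \<open>b\<close> is free to be identified with
    \<open>e b\<close>.\<close>
  then obtain a b where abN: "a \<in> N - e ` N" "b \<in> N - e ` N" and "a \<noteq> b"
    by (metis card_le_Suc0_iff_eq Suc_1 not_less_eq_eq card.infinite le_zero_eq
        numeral_2_eq_2 nat.simps(3))
  then have na: "e a \<noteq> a" by (metis DiffD1 DiffD2 imageI)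
  have epsa: "has (id(a := e a))" using has_eps_of_idem[OF e] abN na by auto
  have const: "p = q" if pq: "p \<in> e ` N" "q \<in> e ` N" for p q
  proof (rule ccontr)
    assume "p \<noteq> q"
    \<comment> \<open>\<open>g\<close> carries \<open>p\<close> and \<open>q\<close> to \<open>b\<close> and \<open>e b\<close>, which \<open>e\<close> identifies.\<close>
    let ?t = "transpose q (e b) \<circ> transpose p b"
    define g where "g = ?t \<circ> id(a := e a)"
    have ne: "a \<noteq> p" "a \<noteq> q" "b \<noteq> p" "b \<noteq> q" "a \<noteq> e b" "b \<noteq> e b"
      using abN pq by auto
    have inN: "p \<in> N" "q \<in> N" "e b \<in> N" "a \<in> N" "b \<in> N" "e a \<in> N" using pq abN eN by auto
    have tb: "bij_betw (transpose x y) (N - {a}) (N - {a})" if "x \<in> N - {a}" "y \<in> N - {a}" for x y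
      by (rule bij_betw_byWitness[where f' = "transpose x y"])
        (use that in \<open>auto simp: transpose_def\<close>)
    have "bij_betw ?t (N - {a}) (N - {a})"
      by (rule bij_betw_trans[OF tb tb]) (use ne inN \<open>a \<noteq> b\<close> in auto)
    then have "in_group N (e a) a g" using in_group_eps[OF na, of N]
      by (auto simp: in_group_def g_def intro: bij_betw_trans)
    then have "has g"
      by (intro has_in_group[OF epsa]) (use inN na in \<open>auto simp: g_def transpose_mem\<close>)
    then have ege: "has (e \<circ> (g \<circ> e))" using e has_comp by blast
    have gp: "g p = b" "g q = e b"
      using ne \<open>p \<noteq> q\<close> by (auto simp: g_def)
    have "\<not> inj_on (e \<circ> g) (e ` N)"
      using inj_onD[of "e \<circ> g" "e ` N" p q] pq gp \<open>p \<noteq> q\<close> eN(2)[OF inN(5)] by auto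
    then have "card ((e \<circ> g) ` e ` N) < card (e ` N)"
      using fin by (metis card_image_le eq_card_imp_inj_on finite_imageI le_neq_implies_less)
    then have "r (e \<circ> (g \<circ> e)) < r e" by (simp add: r_def image_comp comp_assoc)
    with min[OF ege] show False by simp
  qed
  define c where "c = e a"
  have c: "c \<in> N" using eN abN by (auto simp: c_def)
  have "has (\<lambda>_. c)"
    by (rule has_cong[OF e(1)]) (use const abN in \<open>auto simp: c_def\<close>)
  \<comment> \<open>The value \<open>c\<close> lies in the image of \<open>e\<close>, while
    \<open>a\<close> and \<open>b\<close> do not.\<close>
  moreover have "card N > 2"
  proof -
    have "card {a, b, c} \<le> card N" using abN c fin by (intro card_mono) auto
    moreover have "c \<noteq> a" "c \<noteq> b" using abN na unfolding c_def by blast+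
    ultimately show ?thesis using \<open>a \<noteq> b\<close> by simp
  qed
  ultimately show ?thesis using has_noninj_if_const c f by blast
qed

section \<open>Semigroups with neither permutations nor all singular maps\<close>

definition edges :: "('a \<times> 'a) set" where
  "edges = {(m, k). m \<in> N \<and> k \<in> N \<and> m \<noteq> k \<and> has (id(k := m))}"

text \<open>By \<open>has_noninj_if_two_not_fixed\<close> every idempotent of \<open>T\<close> moves
  at most one point, so the members are exactly the group elements over \<open>edges\<close>. The
  same bound, applied to products of two such idempotents, restricts which edges can
  coexist.\<close>

lemma classification_without_permutations:
  assumes noninj: "\<nexists>f. has f \<and> inj_on f N" and ne: "\<exists>f. has f"
    and notall: "\<not> (\<forall>f \<in> N \<rightarrow> N. \<not> inj_on f N \<longrightarrow> has f)"
  shows "\<And>f. f \<in> N \<rightarrow> N \<Longrightarrow> has f \<longleftrightarrow> (\<exists>(m, k) \<in> edges. in_group N m k f)"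
    and "(\<exists>k M. k \<in> N \<and> M \<noteq> {} \<and> M \<subseteq> N - {k} \<and> edges = (\<lambda>m. (m, k)) ` M) \<or>
         (\<exists>m k. m \<in> N \<and> k \<in> N \<and> m \<noteq> k \<and> edges = {(m, k), (k, m)})"
proof -
  have uniq: "a = b" if "has e" "idem_on N e" "a \<in> N" "b \<in> N" "e a \<noteq> a" "e b \<noteq> b" for e a b
    using has_noninj_if_two_not_fixed[OF that(1-4) _ that(5,6)] notall by blast
  have ex: "\<exists>(m, k) \<in> edges. in_group N m k f" if f: "has f" for f
  proof -
    obtain e b j where e: "has e" "idem_on N e" "b \<in> N" "e b \<noteq> b" and j: "j > 0" "e = f ^^ j"

    proof (rule ex_idem_not_fixed[OF f])
      show "\<not> inj_on f N" using noninj f by blast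
    qed
    have eb: "e b \<in> N" using e by (auto simp: idem_on_def)
    have "(id(b := e b)) x = e x" if "x \<in> N" for x
      using uniq[OF e(1,2) that e(3) _ e(4)] by (cases "x = b") fastforce+
    then have "in_group N (e b) b e"
      by (rule in_group_cong[OF in_group_eps[OF e(4)]]) (use e eb in auto)
    then have "in_group N (e b) b f"
      using in_group_root[OF fin has_Pi[OF f] eb e(3,4) j(1)] j(2) by simp
    moreover have "(e b, b) \<in> edges" using e eb has_eps_of_idem[OF e] by (simp add: edges_def)
    ultimately show ?thesis by blast
  qed
  then show "\<And>f. f \<in> N \<rightarrow> N \<Longrightarrow> has f \<longleftrightarrow> (\<exists>(m, k) \<in> edges. in_group N m k f)"
    using has_in_group by (fastforce simp: edges_def)
  \<comment> \<open>Otherwise \<open>id(k := m)\<close> followed by \<open>id(k' := m')\<close>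
    takes neither the value \<open>k\<close> nor \<open>k'\<close>, so it is an idempotent that
    moves both points.\<close>
  have compat: "k = k' \<or> k = m'"
    if E: "(m, k) \<in> edges" "(m', k') \<in> edges" for m k m' k'
  proof (rule ccontr)
    assume *: "\<not> (k = k' \<or> k = m')"
    let ?e = "id(k' := m') \<circ> id(k := m)"
    have E': "m \<in> N" "k \<in> N" "m \<noteq> k" "m' \<in> N" "k' \<in> N" "m' \<noteq> k'"
      and h: "has (id(k := m))" "has (id(k' := m'))" using E by (auto simp: edges_def)
    have "has ?e" by (rule has_comp[OF h])
    moreover have "idem_on N ?e" using E' * by (auto simp: idem_on_def)
    moreover have "?e k \<noteq> k" "?e k' \<noteq> k'" using E' *[simplified] by (simp_all, metis)
    ultimately show False using uniq[of ?e k k'] E' * by blast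
  qed
  obtain m0 k0 where 0: "(m0, k0) \<in> edges" using ne ex by blast
  show "(\<exists>k M. k \<in> N \<and> M \<noteq> {} \<and> M \<subseteq> N - {k} \<and> edges = (\<lambda>m. (m, k)) ` M) \<or>
         (\<exists>m k. m \<in> N \<and> k \<in> N \<and> m \<noteq> k \<and> edges = {(m, k), (k, m)})"
  proof (cases "\<exists>m k. (m, k) \<in> edges \<and> k \<noteq> k0")
    case True
    then obtain m1 k1 where 1: "(m1, k1) \<in> edges" "k1 \<noteq> k0" by blast
    \<comment> \<open>With different second components, compatibility in both orders forces the two
      edges to be opposite. Any further edge is compatible with both and so coincides with one of
      them.\<close>
    have eq: "k1 = m0" "m1 = k0" using compat[OF 0 1(1)] compat[OF 1(1) 0] 1(2) by auto
    have "edges = {(m0, k0), (k0, m0)}"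
    proof (intro equalityI subsetI)
      fix p assume p: "p \<in> edges"
      obtain m k where mk: "p = (m, k)" by (cases p)
      show "p \<in> {(m0, k0), (k0, m0)}"
        using compat[OF 0 p[unfolded mk]] compat[OF 1(1) p[unfolded mk]] compat[OF p[unfolded mk] 0]
          eq 1(2) unfolding mk by auto
    qed (use 0 1 eq in auto)
    moreover have "m0 \<in> N" "k0 \<in> N" "m0 \<noteq> k0" using 0 by (auto simp: edges_def)
    ultimately show ?thesis by blast
  next
    case False
    let ?M = "{m. (m, k0) \<in> edges}"
    have eq: "edges = (\<lambda>m. (m, k0)) ` ?M"
    proof (intro equalityI subsetI)
      fix p assume "p \<in> edges"
      moreover from this False have "snd p = k0" by (cases p) auto
      ultimately have "fst p \<in> ?M" "p = (fst p, k0)" by (auto simp: prod_eq_iff)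
      then show "p \<in> (\<lambda>m. (m, k0)) ` ?M" by blast
    qed blast
    have "k0 \<in> N" "?M \<noteq> {}" "?M \<subseteq> N - {k0}" using 0 by (auto simp: edges_def)
    then show ?thesis by (intro disjI1 exI[of _ k0] exI[of _ ?M] conjI eq)
  qed
qed

end

section \<open>The full transformation semigroup\<close>

text \<open>Since \<open>f m = f k\<close>, both \<open>N - {m}\<close> and \<open>N - {k}\<close>
  are transversals of the kernel of \<open>f\<close>.\<close>

lemma in_group_bij_swap:
  assumes "in_group N m k f" "m \<in> N" "k \<in> N" "m \<noteq> k"
  shows "bij_betw f (N - {m}) (N - {k})"
proof -
  have "bij_betw (transpose m k) (N - {m}) (N - {k})"
    by (rule bij_betw_byWitness[where f' = "transpose m k"])
      (use assms in \<open>auto simp: transpose_def\<close>)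
  then have "bij_betw (f \<circ> transpose m k) (N - {m}) (N - {k})"
    using assms by (auto simp: in_group_def intro: bij_betw_trans)
  moreover have "bij_betw (f \<circ> transpose m k) (N - {m}) (N - {k}) = bij_betw f (N - {m}) (N - {k})"
    by (rule bij_betw_cong) (use assms in \<open>auto simp: in_group_def transpose_def\<close>)
  ultimately show ?thesis by simp
qed

text \<open>Treats both families of unions of groups at once: edges with a common second component,
  and two opposite edges.\<close>

definition groups_of :: "'a set \<Rightarrow> ('a \<times> 'a) set \<Rightarrow> ('a \<Rightarrow> 'a) set" where
  "groups_of N E = {f \<in> N \<rightarrow>\<^sub>E N. \<exists>(m, k) \<in> E. in_group N m k f}"

text \<open>The converse of the classification, under the same compatibility condition. A product
  has the kernel of its first factor and the image of its second: with a common \<open>k\<close> it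
  stays in the group of the first factor, and for opposite edges it lands in the group of the
  second. Roots are handled by \<open>in_group_root\<close>.\<close>

lemma isolated_groups_of:
  assumes fin: "finite N"
    and valid: "\<And>m k. (m, k) \<in> E \<Longrightarrow> m \<in> N \<and> k \<in> N \<and> m \<noteq> k"
    and compat: "\<And>m k m' k'. (m, k) \<in> E \<Longrightarrow> (m', k') \<in> E \<Longrightarrow> k = k' \<or> k = m'"
  shows "isolated_transformations N (groups_of N E)"
proof
  show "finite N" by (rule fin)
  show "groups_of N E \<subseteq> N \<rightarrow>\<^sub>E N" by (auto simp: groups_of_def)
next
  fix f g assume "f \<in> groups_of N E" "g \<in> groups_of N E"
  then obtain m k m' k' where f: "f \<in> N \<rightarrow>\<^sub>E N" "(m, k) \<in> E" "in_group N m k f"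
    and g: "g \<in> N \<rightarrow>\<^sub>E N" "(m', k') \<in> E" "in_group N m' k' g"
    by (auto simp: groups_of_def)
  have v: "m \<in> N" "k \<in> N" "m \<noteq> k" "m' \<in> N" "k' \<in> N" "m' \<noteq> k'" using valid f g by blast+
  have "\<exists>(m, k) \<in> E. in_group N m k (g \<circ> f)"
  proof (cases "k = k'")
    case True
    then have "in_group N m k (g \<circ> f)"
      using f g by (auto simp: in_group_def intro: bij_betw_trans)
    then show ?thesis using f by blast
  next
    case False
    then have mk: "m' = k" "k' = m" using compat[OF f(2) g(2)] compat[OF g(2) f(2)] by auto
    have "bij_betw (g \<circ> f) (N - {m}) (N - {m})"
      using in_group_bij_swap[OF f(3) v(1-3)] in_group_bij_swap[OF g(3) v(4-6)] mk
      by (auto intro: bij_betw_trans)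
    then have "in_group N k m (g \<circ> f)" using f(3) by (simp add: in_group_def)
    then show ?thesis using g mk by blast
  qed
  then obtain a b where ab: "(a, b) \<in> E" "in_group N a b (g \<circ> f)" by blast
  have "in_group N a b (compose N g f)"
    by (rule in_group_cong[OF ab(2)]) (use valid[OF ab(1)] in \<open>auto simp: compose_def\<close>)
  moreover have "compose N g f \<in> N \<rightarrow>\<^sub>E N" using f g by (auto simp: compose_def)
  ultimately show "compose N g f \<in> groups_of N E" using ab by (auto simp: groups_of_def)
next
  fix f :: "'a \<Rightarrow> 'a" and j :: nat
  assume f: "f \<in> N \<rightarrow>\<^sub>E N" and j: "j > 0" and "restrict (f ^^ j) N \<in> groups_of N E"
  then obtain m k where mk: "(m, k) \<in> E" "in_group N m k (restrict (f ^^ j) N)"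
    by (auto simp: groups_of_def)
  then have "in_group N m k (f ^^ j)"
    by (auto intro: in_group_cong[OF mk(2)] dest: valid)
  moreover have "f \<in> N \<rightarrow> N" "m \<in> N" "k \<in> N" "m \<noteq> k" using f valid[OF mk(1)] by auto
  ultimately have "in_group N m k f" using in_group_root[OF fin _ _ _ _ j] by blast
  then show "f \<in> groups_of N E" using f mk unfolding groups_of_def by blast
qed

section \<open>Transfer to the monoid of all transformations\<close>

lemma carrier_full_transformation: "carrier (full_transformation n) = {1..n} \<rightarrow>\<^sub>E {1..n}"
  by (simp add: full_transformation_def)

lemma mult_full_transformation: "f \<otimes>\<^bsub>full_transformation n\<^esub> g = compose {1..n} g f"
  by (simp add: full_transformation_def)

lemma pow_full_transformation:
  assumes "f \<in> {1..n} \<rightarrow>\<^sub>E {1..n}"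
  shows "f [^]\<^bsub>full_transformation n\<^esub> j = restrict (f ^^ j) {1..n}"
proof (induction j)
  case 0
  show ?case by (auto simp: full_transformation_def nat_pow_def fun_eq_iff)
next
  case (Suc j)
  interpret monoid "full_transformation n" by (rule monoid_full_transformation)
  have "f [^]\<^bsub>full_transformation n\<^esub> Suc j = compose {1..n} f (restrict (f ^^ j) {1..n})"
    by (simp only: nat_pow_Suc Suc mult_full_transformation)
  then show ?case by (auto simp: compose_def fun_eq_iff)
qed

lemma subsemigroup_full_transformation_iff:
  "subsemigroup T (full_transformation n) \<longleftrightarrow>
     T \<noteq> {} \<and> T \<subseteq> {1..n} \<rightarrow>\<^sub>E {1..n} \<and> (\<forall>f\<in>T. \<forall>g\<in>T. compose {1..n} g f \<in> T)"
  by (simp add: subsemigroup_def carrier_full_transformation mult_full_transformation)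

lemma isolated_iff:
  "T \<in> isolated_subsemigroups (full_transformation n) \<longleftrightarrow>
     T \<noteq> {} \<and> isolated_transformations {1..n} T"
proof -
  have "(\<forall>f\<in>carrier (full_transformation n). (\<exists>j>0. f [^]\<^bsub>full_transformation n\<^esub> (j::nat) \<in> T) \<longrightarrow> f \<in> T)
    \<longleftrightarrow> (\<forall>f j. f \<in> {1..n} \<rightarrow>\<^sub>E {1..n} \<longrightarrow> 0 < j \<longrightarrow> restrict (f ^^ j) {1..n} \<in> T \<longrightarrow> f \<in> T)"
    unfolding carrier_full_transformation using pow_full_transformation by metis
  then show ?thesis
    unfolding isolated_subsemigroups_def isolated_transformations_def
      subsemigroup_full_transformation_iff mem_Collect_eq by blast
qed

lemma Bij_iff_inj_on:
  assumes "finite N"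
  shows "f \<in> Bij N \<longleftrightarrow> f \<in> N \<rightarrow>\<^sub>E N \<and> inj_on f N"
proof
  assume "f \<in> Bij N"
  then show "f \<in> N \<rightarrow>\<^sub>E N \<and> inj_on f N" by (auto simp: Bij_def bij_betw_def PiE_def)
next
  assume f: "f \<in> N \<rightarrow>\<^sub>E N \<and> inj_on f N"
  then have "f ` N = N" by (intro endo_inj_surj[OF assms]) auto
  then show "f \<in> Bij N" using f by (simp add: Bij_def bij_betw_def PiE_def)
qed

lemma inj_on_compose_iff:
  assumes "finite N" "f \<in> N \<rightarrow>\<^sub>E N" "g \<in> N \<rightarrow>\<^sub>E N"
  shows "inj_on (compose N g f) N \<longleftrightarrow> inj_on f N \<and> inj_on g N"
proof -
  have "inj_on (compose N g f) N \<longleftrightarrow> inj_on (g \<circ> f) N"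
    by (rule inj_on_cong) (simp add: compose_def)
  moreover have "inj_on (g \<circ> f) N \<longleftrightarrow> inj_on f N \<and> inj_on g N"
  proof (cases "inj_on f N")
    case True
    then have "f ` N = N" using assms by (intro endo_inj_surj) auto
    then show ?thesis using True comp_inj_on_iff[OF True, of g] by simp
  next
    case False
    then show ?thesis by (auto dest: inj_on_imageI2)
  qed
  ultimately show ?thesis by simp
qed

lemma compose_PiE: "f \<in> N \<rightarrow>\<^sub>E N \<Longrightarrow> g \<in> N \<rightarrow>\<^sub>E N \<Longrightarrow> compose N g f \<in> N \<rightarrow>\<^sub>E N"
  by (auto simp: compose_def)

text \<open>One direction makes the symmetric group convex; the other makes its complement
  completely isolated.\<close>

lemma mult_in_Bij_iff:
  assumes "f \<in> carrier (full_transformation n)" "g \<in> carrier (full_transformation n)"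
  shows "f \<otimes>\<^bsub>full_transformation n\<^esub> g \<in> Bij {1..n} \<longleftrightarrow> f \<in> Bij {1..n} \<and> g \<in> Bij {1..n}"
proof -
  have fg: "f \<in> {1..n} \<rightarrow>\<^sub>E {1..n}" "g \<in> {1..n} \<rightarrow>\<^sub>E {1..n}"
    using assms by (simp_all only: carrier_full_transformation)
  show ?thesis
    unfolding mult_full_transformation Bij_iff_inj_on[OF finite_atLeastAtMost]
      inj_on_compose_iff[OF finite_atLeastAtMost fg]
    using fg compose_PiE[OF fg] by blast
qed

lemma Bij_subsemigroup: "subsemigroup (Bij {1..n}) (full_transformation n)"
proof -
  have "(\<lambda>x\<in>{1..n}. x) \<in> Bij {1..n}" by (auto simp: Bij_iff_inj_on inj_on_def)
  moreover have "Bij {1..n} \<subseteq> {1..n} \<rightarrow>\<^sub>E {1..n}"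
    using Bij_iff_inj_on[of "{1..n}"] by blast
  moreover have "compose {1..n} g f \<in> Bij {1..n}" if "f \<in> Bij {1..n}" "g \<in> Bij {1..n}" for f g
    using that by (simp add: Bij_iff_inj_on inj_on_compose_iff compose_PiE)
  ultimately show ?thesis unfolding subsemigroup_full_transformation_iff by blast
qed

lemma carrier_subsemigroup: "subsemigroup (carrier (full_transformation n)) (full_transformation n)"
  unfolding subsemigroup_full_transformation_iff carrier_full_transformation
  using compose_PiE by (auto simp: PiE_eq_empty_iff)

lemma singular_subsemigroup:
  assumes "n \<ge> 2"
  shows "subsemigroup (carrier (full_transformation n) - Bij {1..n}) (full_transformation n)"
proof -
  \<comment> \<open>A constant map witnesses non-emptiness; it is singular because there are at
    least two points.\<close>
  let ?c = "\<lambda>x\<in>{1..n}. 1"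
  have "?c \<in> {1..n} \<rightarrow>\<^sub>E {1..n}" using assms by simp
  moreover have "\<not> inj_on ?c {1..n}"
  proof
    assume "inj_on ?c {1..n}"
    from inj_onD[OF this, of 1 2] assms show False by simp
  qed
  ultimately have "?c \<in> carrier (full_transformation n) - Bij {1..n}"
    unfolding carrier_full_transformation using Bij_iff_inj_on[of "{1..n}" ?c] by blast
  moreover have "compose {1..n} g f \<in> carrier (full_transformation n) - Bij {1..n}"
    if "f \<in> carrier (full_transformation n) - Bij {1..n}"
      "g \<in> carrier (full_transformation n) - Bij {1..n}" for f g
    using that by (simp add: carrier_full_transformation Bij_iff_inj_on inj_on_compose_iff compose_PiE)
  ultimately show ?thesis
    unfolding subsemigroup_full_transformation_iff carrier_full_transformation by blast
qed

section \<open>Isolated subsemigroups\<close>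

lemma Geps_iff:
  assumes "m \<in> {1..n}" "k \<in> {1..n}" "m \<noteq> k"
  shows "f \<in> Geps n m k \<longleftrightarrow> f \<in> {1..n} \<rightarrow>\<^sub>E {1..n} \<and> in_group {1..n} m k f"
  unfolding Geps_eq[OF assms] carrier_full_transformation in_group_def by blast

lemma Union_Geps_eq:
  assumes "k \<in> {1..n}" "M \<subseteq> {1..n} - {k}"
  shows "(\<Union>m\<in>M. Geps n m k) = groups_of {1..n} ((\<lambda>m. (m, k)) ` M)"
proof -
  have "f \<in> Geps n m k \<longleftrightarrow> f \<in> {1..n} \<rightarrow>\<^sub>E {1..n} \<and> in_group {1..n} m k f" if "m \<in> M" for m f
    by (rule Geps_iff) (use assms that in auto)
  then show ?thesis unfolding groups_of_def by blast
qed

lemma Geps_Un_Geps_eq: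
  assumes "m \<in> {1..n}" "k \<in> {1..n}" "m \<noteq> k"
  shows "Geps n m k \<union> Geps n k m = groups_of {1..n} {(m, k), (k, m)}"
  using assms Geps_iff[OF assms] Geps_iff[OF assms(2,1) assms(3)[symmetric]]
  unfolding groups_of_def by blast

lemma groups_of_nonempty:
  assumes "(m, k) \<in> E" "m \<in> N" "k \<in> N" "m \<noteq> k"
  shows "restrict (id(k := m)) N \<in> groups_of N E"
proof -
  have "in_group N m k (restrict (id(k := m)) N)"
    by (rule in_group_cong[OF in_group_eps[OF assms(4)]]) (use assms in auto)
  then show ?thesis using assms by (auto simp: groups_of_def)
qed

lemma carrier_isolated:
  "carrier (full_transformation n) \<in> isolated_subsemigroups (full_transformation n)"
  using carrier_subsemigroup[of n] unfolding isolated_subsemigroups_def by blast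

lemma inj_on_pow_full_transformation:
  assumes f: "f \<in> {1..n} \<rightarrow>\<^sub>E {1..n}" and j: "j > 0"
  shows "f [^]\<^bsub>full_transformation n\<^esub> (j::nat) \<in> Bij {1..n} \<longleftrightarrow> f \<in> Bij {1..n}"
proof -
  have f': "f \<in> {1..n} \<rightarrow> {1..n}" using f by auto
  have "restrict (f ^^ j) {1..n} \<in> {1..n} \<rightarrow>\<^sub>E {1..n}"
    using funpow_Pi[OF f', of j] by (simp only: restrict_PiE_iff Pi_iff)
  moreover have "inj_on (restrict (f ^^ j) {1..n}) {1..n} \<longleftrightarrow> inj_on f {1..n}"
    unfolding inj_on_restrict_eq using inj_on_funpowD[OF _ j] inj_on_funpow[OF f'] by blast
  ultimately show ?thesis
    unfolding pow_full_transformation[OF f] Bij_iff_inj_on[OF finite_atLeastAtMost] using f by blast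
qed

lemma Bij_isolated: "Bij {1..n} \<in> isolated_subsemigroups (full_transformation n)"
  using Bij_subsemigroup[of n] inj_on_pow_full_transformation[of _ n]
  unfolding isolated_subsemigroups_def carrier_full_transformation by blast

lemma singular_isolated:
  assumes "n \<ge> 2"
  shows "carrier (full_transformation n) - Bij {1..n} \<in> isolated_subsemigroups (full_transformation n)"
  using singular_subsemigroup[OF assms] inj_on_pow_full_transformation[of _ n]
  unfolding isolated_subsemigroups_def carrier_full_transformation by blast

text \<open>Stated from \<open>n = 2\<close> on, where the listed families may overlap, so that the
  two-point case can be read off. The cases are whether \<open>T\<close> contains a permutation,
  then whether it also contains a singular map, or else whether it contains all singular
  maps.\<close>

lemma isolated_full_transformation:
  assumes n: "n \<ge> 2"
  shows "isolated_subsemigroups (full_transformation n) =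
        {carrier (full_transformation n), Bij {1..n}, carrier (full_transformation n) - Bij {1..n}}
        \<union> {(\<Union>m\<in>M. Geps n m k) | k M. k \<in> {1..n} \<and> M \<noteq> {} \<and> M \<subseteq> {1..n} - {k}}
        \<union> {Geps n m k \<union> Geps n k m | m k. m \<in> {1..n} \<and> k \<in> {1..n} \<and> m \<noteq> k}"
    (is "?I = ?A \<union> ?B \<union> ?C")
proof (intro equalityI subsetI)
  let ?N = "{1..n}"
  fix T assume "T \<in> ?I"
  then have ne: "T \<noteq> {}" and "isolated_transformations ?N T" by (auto simp: isolated_iff)
  then interpret isolated_transformations ?N T by simp
  have mem: "f \<in> T \<longleftrightarrow> f \<in> ?N \<rightarrow>\<^sub>E ?N \<and> has f" for f
    using sub mem_iff_has[of f] by blast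
  have Pi: "f \<in> ?N \<rightarrow> ?N" if "f \<in> ?N \<rightarrow>\<^sub>E ?N" for f :: "nat \<Rightarrow> nat" using that by auto
  show "T \<in> ?A \<union> ?B \<union> ?C"
  proof (cases "\<exists>f. has f \<and> inj_on f ?N")
    case True
    then obtain f where f: "has f" "inj_on f ?N" by blast
    show ?thesis
    proof (cases "\<exists>g. has g \<and> \<not> inj_on g ?N")
      case True
      then have "has h" if "h \<in> ?N \<rightarrow> ?N" for h using has_all[OF f] that by blast
      then have "T = carrier (full_transformation n)"
        using mem Pi unfolding carrier_full_transformation by blast
      then show ?thesis by simp
    next
      case False
      then have "has h \<longleftrightarrow> inj_on h ?N" if "h \<in> ?N \<rightarrow> ?N" for h using has_bij[OF f] that by blast
      then have "f \<in> T \<longleftrightarrow> f \<in> Bij ?N" for f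
        unfolding mem Bij_iff_inj_on[OF fin] using Pi[of f] by blast
      then have "T = Bij ?N" by blast
      then show ?thesis by simp
    qed
  next
    case no_inj: False
    then have noninj: "\<not> inj_on f ?N" if "has f" for f using that by blast
    show ?thesis
    proof (cases "\<forall>f \<in> ?N \<rightarrow> ?N. \<not> inj_on f ?N \<longrightarrow> has f")
      case True
      have "f \<in> T \<longleftrightarrow> f \<in> carrier (full_transformation n) - Bij ?N" for f
      proof -
        have "has f \<longleftrightarrow> \<not> inj_on f ?N" if "f \<in> ?N \<rightarrow>\<^sub>E ?N" using True noninj Pi[OF that] by blast
        then show ?thesis
          unfolding mem carrier_full_transformation Diff_iff using Bij_iff_inj_on[of ?N f] by blast
      qed
      then have "T = carrier (full_transformation n) - Bij ?N" by blast
      then show ?thesis by simp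
    next
      case False
      have "\<exists>f. has f" using ne mem by blast
      note cl = classification_without_permutations[OF no_inj this False]
      have T: "T = groups_of ?N edges"
      proof -
        have "f \<in> T \<longleftrightarrow> f \<in> groups_of ?N edges" for f
          using cl(1)[OF Pi] unfolding mem groups_of_def by blast
        then show ?thesis by blast
      qed
      from cl(2) show ?thesis
      proof (elim disjE exE conjE)
        fix k M assume *: "k \<in> ?N" "M \<noteq> {}" "M \<subseteq> ?N - {k}" "edges = (\<lambda>m. (m, k)) ` M"
        then have "T = (\<Union>m\<in>M. Geps n m k)" using T Union_Geps_eq by metis
        then show ?thesis using * by blast
      next
        fix m k assume *: "m \<in> ?N" "k \<in> ?N" "m \<noteq> k" "edges = {(m, k), (k, m)}"
        then have "T = Geps n m k \<union> Geps n k m" using T Geps_Un_Geps_eq by metis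
        then show ?thesis using * by blast
      qed
    qed
  qed
next
  show "T \<in> ?I" if "T \<in> ?A \<union> ?B \<union> ?C" for T
    using that
  proof (elim UnE)
    assume "T \<in> ?A"
    then show ?thesis
      using carrier_isolated Bij_isolated singular_isolated[OF n] by (elim insertE emptyE) simp_all
  next
    assume "T \<in> ?B"
    then obtain k M where kM: "k \<in> {1..n}" "M \<noteq> {}" "M \<subseteq> {1..n} - {k}" "T = (\<Union>m\<in>M. Geps n m k)"
      by blast
    let ?E = "(\<lambda>m. (m, k)) ` M"
    obtain m where "m \<in> M" using kM by blast
    then have "groups_of {1..n} ?E \<noteq> {}" using groups_of_nonempty[of m k ?E "{1..n}"] kM by blast
    moreover have "isolated_transformations {1..n} (groups_of {1..n} ?E)"
      by (rule isolated_groups_of) (use kM in auto)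
    ultimately show ?thesis unfolding kM(4) Union_Geps_eq[OF kM(1,3)] isolated_iff by blast
  next
    assume "T \<in> ?C"
    then obtain m k where mk: "m \<in> {1..n}" "k \<in> {1..n}" "m \<noteq> k" "T = Geps n m k \<union> Geps n k m"
      by blast
    let ?E = "{(m, k), (k, m)}"
    have "groups_of {1..n} ?E \<noteq> {}" using groups_of_nonempty[of m k ?E "{1..n}"] mk by blast
    moreover have "isolated_transformations {1..n} (groups_of {1..n} ?E)"
      by (rule isolated_groups_of) (use mk in auto)
    ultimately show ?thesis unfolding mk(4) Geps_Un_Geps_eq[OF mk(1-3)] isolated_iff by blast
  qed
qed

section \<open>Obstructions to complete isolation\<close>

lemma completely_isolated_imp_isolated:
  assumes "monoid S"
  shows "completely_isolated_subsemigroups S \<subseteq> isolated_subsemigroups S"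
proof
  interpret monoid S by (rule assms)
  fix T assume T: "T \<in> completely_isolated_subsemigroups S"
  have "x \<in> T" if "x \<in> carrier S" "x [^]\<^bsub>S\<^esub> j \<in> T" "j > 0" for x and j :: nat
    using that(2,3)
  proof (induction j)
    case (Suc j)
    show ?case
    proof (cases "j = 0")
      case False
      have "x [^]\<^bsub>S\<^esub> j \<in> T \<or> x \<in> T"
        using Suc.prems(1) T that(1) by (simp add: completely_isolated_subsemigroups_def)
      then show ?thesis using Suc.IH False by blast
    qed (use Suc that in simp)
  qed simp
  then show "T \<in> isolated_subsemigroups S"
    using T by (auto simp: completely_isolated_subsemigroups_def isolated_subsemigroups_def)
qed

text \<open>Every member of the union has \<open>p\<close> in its image, because only second
  components of edges are missed. Yet \<open>id(k := m)\<close> is a product of \<open>x\<close>,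
  whose image misses \<open>p\<close>, and the permutation \<open>y\<close> exchanging
  \<open>k\<close> and \<open>p\<close>; neither factor belongs to the union.\<close>

lemma groups_of_not_completely_isolated:
  assumes valid: "\<And>m k. (m, k) \<in> E \<Longrightarrow> m \<in> {1..n} \<and> k \<in> {1..n} \<and> m \<noteq> k"
    and mk: "(m, k) \<in> E" and p: "p \<in> {1..n}" "p \<notin> snd ` E"
  shows "groups_of {1..n} E \<notin> completely_isolated_subsemigroups (full_transformation n)"
proof
  let ?N = "{1..n}"
  assume *: "groups_of ?N E \<in> completely_isolated_subsemigroups (full_transformation n)"
  define y where "y = restrict (transpose k p) ?N"
  define x where "x = restrict (transpose k p \<circ> id(k := m)) ?N"
  have v: "m \<in> ?N" "k \<in> ?N" "m \<noteq> k" using valid[OF mk] by auto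
  have not_p: "x z \<noteq> p" if "z \<in> ?N" for z
    using that v by (auto simp: x_def transpose_def)
  have yN: "y \<in> ?N \<rightarrow>\<^sub>E ?N" using p v by (auto simp: y_def transpose_def)
  have xN: "x \<in> ?N \<rightarrow>\<^sub>E ?N" using p v by (auto simp: x_def transpose_def)
  have "y (x z) = (id(k := m)) z" if "z \<in> ?N" for z
    using PiE_mem[OF xN that] that unfolding y_def by (simp add: x_def)
  then have "compose ?N y x = restrict (id(k := m)) ?N"
    unfolding compose_def by (intro restrict_ext)
  then have "compose ?N y x \<in> groups_of ?N E" using groups_of_nonempty[OF mk v] by simp
  then have "x \<in> groups_of ?N E \<or> y \<in> groups_of ?N E"
    using * xN yN by (simp add: completely_isolated_subsemigroups_def carrier_full_transformation
        mult_full_transformation)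
  then show False
  proof
    assume "x \<in> groups_of ?N E"
    then obtain a b where ab: "(a, b) \<in> E" "in_group ?N a b x" by (auto simp: groups_of_def)
    have "x ` ?N = ?N - {b}" using in_group_image[OF ab(2)] valid[OF ab(1)] by blast
    moreover have "p \<noteq> b" using p ab by force
    ultimately show False using not_p p by (metis DiffI imageE singletonD)
  next
    assume "y \<in> groups_of ?N E"
    then obtain a b where ab: "(a, b) \<in> E" "in_group ?N a b y" by (auto simp: groups_of_def)
    then have "y a = y b" by (simp add: in_group_def)
    then show False using valid[OF ab(1)] by (auto simp: y_def dest: transpose_eq_imp_eq)
  qed
qed

lemma Union_Geps_not_completely_isolated:
  assumes "k \<in> {1..n}" "M \<noteq> {}" "M \<subseteq> {1..n} - {k}"
  shows "(\<Union>m\<in>M. Geps n m k) \<notin> completely_isolated_subsemigroups (full_transformation n)"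
proof -
  obtain m where m: "m \<in> M" using assms by blast
  show ?thesis unfolding Union_Geps_eq[OF assms(1,3)]
    \<comment> \<open>Here \<open>m\<close> itself serves as \<open>p\<close>, since
      \<open>k\<close> is the only second component.\<close>
    by (rule groups_of_not_completely_isolated[of _ _ m k m]) (use assms m in auto)
qed

lemma Geps_Un_Geps_not_completely_isolated:
  assumes "m \<in> {1..n}" "k \<in> {1..n}" "m \<noteq> k" "n > 2"
  shows "Geps n m k \<union> Geps n k m \<notin> completely_isolated_subsemigroups (full_transformation n)"
proof -
  \<comment> \<open>Both \<open>m\<close> and \<open>k\<close> are second components, so
    \<open>p\<close> has to be a third point.\<close>
  have "\<not> {1..n} \<subseteq> {m, k}" using card_mono[of "{m, k}" "{1..n}"] assms by auto
  then obtain p where p: "p \<in> {1..n}" "p \<noteq> m" "p \<noteq> k" by blast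
  show ?thesis unfolding Geps_Un_Geps_eq[OF assms(1-3)]
    by (rule groups_of_not_completely_isolated[of _ _ m k p]) (use assms p in auto)
qed

section \<open>The case of two points\<close>

text \<open>The permuted set is the singleton of \<open>m\<close>, so the group consists of one
  constant map.\<close>

lemma Geps_2:
  assumes "m \<in> {1..2}" "k \<in> {1..2}" "m \<noteq> k"
  shows "f \<in> Geps 2 m k \<longleftrightarrow> f \<in> {1..2} \<rightarrow>\<^sub>E {1..2} \<and> f m = m \<and> f k = m"
proof -
  have "{1..2} - {k} = {m}" using assms by auto
  then show ?thesis using Geps_iff[OF assms] by (auto simp: in_group_def bij_betw_def)
qed

lemma Geps_2_Un:
  assumes "m \<in> {1..2}" "k \<in> {1..2}" "m \<noteq> k"
  shows "Geps 2 m k \<union> Geps 2 k m = carrier (full_transformation 2) - Bij {1..2}"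
proof -
  have N: "{1..2} = {m, k}" using assms by auto
  have "f \<in> Geps 2 m k \<union> Geps 2 k m \<longleftrightarrow> f \<in> {1..2} \<rightarrow>\<^sub>E {1..2} \<and> \<not> inj_on f {1..2}" for f
  proof (cases "f \<in> {1..2} \<rightarrow>\<^sub>E {1..2}")
    case True
    then have "f m = m \<or> f m = k" "f k = m \<or> f k = k" using N by blast+
    moreover have "inj_on f {1..2} \<longleftrightarrow> f m \<noteq> f k"
      using assms(3) unfolding N by auto
    ultimately show ?thesis
      using True Geps_2[OF assms] Geps_2[OF assms(2,1) assms(3)[symmetric]] assms(3) by auto
  next
    case False
    then show ?thesis using Geps_2[OF assms] Geps_2[OF assms(2,1) assms(3)[symmetric]] by blast
  qed
  then show ?thesis unfolding carrier_full_transformation using Bij_iff_inj_on[of "{1..2}"] by blast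
qed

text \<open>With two points \<open>M\<close> can only be the singleton complement of
  \<open>k\<close>, and by \<open>Geps_2_Un\<close> the unions of two opposite groups are the
  singular part, already listed.\<close>

lemma isolated_full_transformation_2:
  "isolated_subsemigroups (full_transformation 2) =
       {carrier (full_transformation 2), Bij {1..2}, carrier (full_transformation 2) - Bij {1..2},
        Geps 2 1 2, Geps 2 2 1}"
proof -
  have "{(\<Union>m\<in>M. Geps 2 m k) | k M. k \<in> {1..2} \<and> M \<noteq> {} \<and> M \<subseteq> {1..2} - {k}}
      = {Geps 2 1 2, Geps 2 2 1}" (is "?L = ?R")
  proof (intro equalityI subsetI)
    fix T assume "T \<in> ?L"
    then obtain k M where *: "k \<in> {1..2}" "M \<noteq> {}" "M \<subseteq> {1..2} - {k}" "T = (\<Union>m\<in>M. Geps 2 m k)"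
      by blast
    have "k = 1 \<or> k = 2" using *(1) by auto
    then have "k = 1 \<and> {1..2} - {k} = {2} \<or> k = 2 \<and> {1..2} - {k} = {1}" by auto
    then show "T \<in> ?R" using *(2-4) by (auto simp: subset_singleton_iff)
  next
    fix T assume "T \<in> ?R"
    then have "T = (\<Union>m\<in>{1}. Geps 2 m 2) \<or> T = (\<Union>m\<in>{2}. Geps 2 m 1)" by simp
    moreover have "(2::nat) \<in> {1..2} \<and> {1::nat} \<noteq> {} \<and> {1} \<subseteq> {1..2} - {2::nat}"
      "(1::nat) \<in> {1..2} \<and> {2::nat} \<noteq> {} \<and> {2} \<subseteq> {1..2} - {1::nat}" by auto
    ultimately show "T \<in> ?L" by blast
  qed
  moreover have "{Geps 2 m k \<union> Geps 2 k m | m k. m \<in> {1..2} \<and> k \<in> {1..2} \<and> m \<noteq> k}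
      \<subseteq> {carrier (full_transformation 2) - Bij {1..2}}"
    using Geps_2_Un by blast
  moreover have "C \<subseteq> {c} \<Longrightarrow> {a, b, c} \<union> {d, e} \<union> C = {a, b, c, d, e}" for a b c d e :: 'x and C
    by blast
  ultimately show ?thesis unfolding isolated_full_transformation[OF order.refl] by simp
qed

section \<open>Completely isolated and convex subsemigroups\<close>

lemma completely_isolated_full_transformation:
  assumes n: "n \<ge> 2"
  shows "completely_isolated_subsemigroups (full_transformation n) =
    {carrier (full_transformation n), Bij {1..n}, carrier (full_transformation n) - Bij {1..n}}"
    (is "?CI = ?A")
proof (intro equalityI subsetI)
  fix T assume T: "T \<in> ?CI"
  then have "T \<in> isolated_subsemigroups (full_transformation n)"
    using completely_isolated_imp_isolated[OF monoid_full_transformation] by blast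
  then consider "T \<in> ?A"
    | k M where "k \<in> {1..n}" "M \<noteq> {}" "M \<subseteq> {1..n} - {k}" "T = (\<Union>m\<in>M. Geps n m k)"
    | m k where "m \<in> {1..n}" "k \<in> {1..n}" "m \<noteq> k" "T = Geps n m k \<union> Geps n k m"
    unfolding isolated_full_transformation[OF n] by blast
  then show "T \<in> ?A"
  proof cases
    case 2
    have "T \<notin> ?CI" unfolding 2(4) by (rule Union_Geps_not_completely_isolated[OF 2(1-3)])
    then show ?thesis using T by contradiction
  next
    case 3
    show ?thesis
    proof (cases "n = 2")
      case True
      then show ?thesis using 3 Geps_2_Un[of m k] by simp
    next
      case False
      have "T \<notin> ?CI"
        unfolding 3(4) by (rule Geps_Un_Geps_not_completely_isolated[OF 3(1-3)]) (use False n in simp)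
      then show ?thesis using T by contradiction
    qed
  qed
next
  fix T assume "T \<in> ?A"
  then show "T \<in> ?CI"
    using carrier_subsemigroup[of n] Bij_subsemigroup[of n] singular_subsemigroup[OF n]
      mult_in_Bij_iff[of _ n]
    unfolding completely_isolated_subsemigroups_def by (elim insertE emptyE) simp_all
qed

lemma convex_eq: "convex_subsemigroups S = left_convex_subsemigroups S \<inter> right_convex_subsemigroups S"
  by (auto simp: convex_subsemigroups_def left_convex_subsemigroups_def right_convex_subsemigroups_def)

text \<open>One-sided convexity implies complete isolation, which leaves three candidates. The
  singular part is excluded because multiplying a singular map by the identity, on either side,
  gives a singular product with a non-singular factor.\<close>

lemma one_sided_convex_full_transformation:
  assumes n: "n \<ge> 2"
  shows "left_convex_subsemigroups (full_transformation n) = {Bij {1..n}, carrier (full_transformation n)}"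
    and "right_convex_subsemigroups (full_transformation n) = {Bij {1..n}, carrier (full_transformation n)}"
proof -
  let ?S = "full_transformation n"
  let ?Sing = "carrier ?S - Bij {1..n}"
  interpret monoid ?S by (rule monoid_full_transformation)
  obtain f where f: "f \<in> ?Sing" using singular_subsemigroup[OF n] by (auto simp: subsemigroup_def)
  have one: "\<one>\<^bsub>?S\<^esub> \<in> Bij {1..n}"
    by (auto simp: full_transformation_def Bij_iff_inj_on inj_on_def)
  have "?Sing \<notin> left_convex_subsemigroups ?S"
  proof
    assume "?Sing \<in> left_convex_subsemigroups ?S"
    then have "\<one>\<^bsub>?S\<^esub> \<otimes>\<^bsub>?S\<^esub> f \<in> ?Sing \<longrightarrow> \<one>\<^bsub>?S\<^esub> \<in> ?Sing"
      using f one_closed unfolding left_convex_subsemigroups_def by blast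
    then show False using f one by simp
  qed
  moreover have "?Sing \<notin> right_convex_subsemigroups ?S"
  proof
    assume "?Sing \<in> right_convex_subsemigroups ?S"
    then have "f \<otimes>\<^bsub>?S\<^esub> \<one>\<^bsub>?S\<^esub> \<in> ?Sing \<longrightarrow> \<one>\<^bsub>?S\<^esub> \<in> ?Sing"
      using f one_closed unfolding right_convex_subsemigroups_def by blast
    then show False using f one by simp
  qed
  moreover have "left_convex_subsemigroups ?S \<subseteq> completely_isolated_subsemigroups ?S"
    "right_convex_subsemigroups ?S \<subseteq> completely_isolated_subsemigroups ?S"
    by (auto simp: left_convex_subsemigroups_def right_convex_subsemigroups_def
        completely_isolated_subsemigroups_def)
  moreover have "{Bij {1..n}, carrier ?S} \<subseteq> left_convex_subsemigroups ?S"
    "{Bij {1..n}, carrier ?S} \<subseteq> right_convex_subsemigroups ?S"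
    using carrier_subsemigroup[of n] Bij_subsemigroup[of n] mult_in_Bij_iff[of _ n]
    unfolding left_convex_subsemigroups_def right_convex_subsemigroups_def by simp_all
  ultimately show "left_convex_subsemigroups ?S = {Bij {1..n}, carrier ?S}"
    "right_convex_subsemigroups ?S = {Bij {1..n}, carrier ?S}"
    unfolding completely_isolated_full_transformation[OF n] by blast+
qed

section \<open>The case of one point and the final assembly\<close>

lemma subsemigroup_full_transformation_1:
  "subsemigroup T (full_transformation 1) \<longleftrightarrow> T = carrier (full_transformation 1)"
proof
  have c: "carrier (full_transformation 1) = {\<lambda>x\<in>{1}. 1}"
    by (simp add: carrier_full_transformation PiE_singleton)
  assume "subsemigroup T (full_transformation 1)"
  then show "T = carrier (full_transformation 1)"
    unfolding subsemigroup_def c by blast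
qed (simp add: carrier_subsemigroup)

lemma subsemigroups_full_transformation_1:
  shows "isolated_subsemigroups (full_transformation 1) = {carrier (full_transformation 1)}"
    and "completely_isolated_subsemigroups (full_transformation 1) = {carrier (full_transformation 1)}"
    and "left_convex_subsemigroups (full_transformation 1) = {carrier (full_transformation 1)}"
    and "right_convex_subsemigroups (full_transformation 1) = {carrier (full_transformation 1)}"
  unfolding isolated_subsemigroups_def completely_isolated_subsemigroups_def
    left_convex_subsemigroups_def right_convex_subsemigroups_def subsemigroup_full_transformation_1
  by auto

theorem proposition31:
  shows
   "(isolated_subsemigroups (full_transformation 1) = {carrier (full_transformation 1)} \<and>
     completely_isolated_subsemigroups (full_transformation 1) = {carrier (full_transformation 1)} \<and>
     left_convex_subsemigroups (full_transformation 1) = {carrier (full_transformation 1)} \<and>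
     right_convex_subsemigroups (full_transformation 1) = {carrier (full_transformation 1)} \<and>
     convex_subsemigroups (full_transformation 1) = {carrier (full_transformation 1)}) \<and>
    (isolated_subsemigroups (full_transformation 2) =
       {carrier (full_transformation 2), Bij {1, 2}, carrier (full_transformation 2) - Bij {1, 2},
        Geps 2 1 2, Geps 2 2 1} \<and>
     completely_isolated_subsemigroups (full_transformation 2) =
       {carrier (full_transformation 2), Bij {1, 2}, carrier (full_transformation 2) - Bij {1, 2}} \<and>
     left_convex_subsemigroups (full_transformation 2) = {Bij {1, 2}, carrier (full_transformation 2)} \<and>
     right_convex_subsemigroups (full_transformation 2) = {Bij {1, 2}, carrier (full_transformation 2)} \<and>
     convex_subsemigroups (full_transformation 2) = {Bij {1, 2}, carrier (full_transformation 2)}) \<and>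
    (\<forall>n::nat. n > 2 \<longrightarrow>
      isolated_subsemigroups (full_transformation n) =
        {carrier (full_transformation n), Bij {1..n}, carrier (full_transformation n) - Bij {1..n}}
        \<union> {(\<Union>m\<in>M. Geps n m k) | k M. k \<in> {1..n} \<and> M \<noteq> {} \<and> M \<subseteq> {1..n} - {k}}
        \<union> {Geps n m k \<union> Geps n k m | m k. m \<in> {1..n} \<and> k \<in> {1..n} \<and> m \<noteq> k} \<and>
      completely_isolated_subsemigroups (full_transformation n) =
        {carrier (full_transformation n), Bij {1..n}, carrier (full_transformation n) - Bij {1..n}} \<and>
      left_convex_subsemigroups (full_transformation n) = {Bij {1..n}, carrier (full_transformation n)} \<and>
      right_convex_subsemigroups (full_transformation n) = {Bij {1..n}, carrier (full_transformation n)} \<and>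
      convex_subsemigroups (full_transformation n) = {Bij {1..n}, carrier (full_transformation n)})"
proof -
  have N: "{1, 2} = {1..2::nat}" by auto
  show ?thesis
    unfolding N isolated_full_transformation_2
    by (intro conjI allI impI isolated_full_transformation completely_isolated_full_transformation)
      (simp_all add: subsemigroups_full_transformation_1 one_sided_convex_full_transformation convex_eq
        completely_isolated_full_transformation del: One_nat_def)
qed

end
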